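(* Let $n \ge 0$ and let $\lambda$ be a noncrossing partition of size $n$. Then the excedance class $\mathcal{C}_\lambda$ is an interval in the Bruhat order on $S_n$, with upper bound $Q_\lambda$ and lower bound given by a $321$-avoiding permutation; that is, there is a $321$-avoiding permutation $T \in S_n$ such that $\mathcal{C}_\lambda = \{ w \in S_n : T \le w \le Q_\lambda\}$.
   Context: Write $[n] = \{1,\dots,n\}$ and let $S_n$ be the group of permutations of $[n]$, with $w_i = w(i)$; $\le$ on $S_n$ is the usual (strong) Bruhat order. A permutation $w$ is $321$-avoiding if there are no $i<j<k$ with $w_i>w_j>w_k$. A noncrossing partition of size $n$ is a set $\lambda$ of arcs $(i,j)$ with $1 \le i < j \le n$ such that there are no two distinct arcs $(i,k), (j,l) \in \lambda$ with $i \le j < k \le l$. $\lambda^{+}$ (resp. $\lambda^{-}$) denotes the set of all left (resp. right) endpoints of arcs of $\lambda$, where $(i,j)$ has left endpoint $i$ and right endpoint $j$. Connectedness in $\lambda$ refers to the undirected graph on $[n]$ whose edges are the arcs. The permutation $Q_\lambda\in S_n$ is defined by $Q_\lambda(j) = i$ if $j\in\lambda^{-}$ and $(i,j)\in\lambda$, and $Q_\lambda(j)=k$ if $j\notin\lambda^{-}$ and $k$ is the largest element of the connected component of $j$ in $\lambda$. For $w \in S_n$, set $E_{pos}(w) = \{ i \in [n] : i \le w_i\}$ and $E_{val}(w) = \{ w_i : i\in[n],\ i \le w_i\}$. The excedance class of $\lambda$ is $\mathcal{C}_\lambda = \{ w \in S_n : E_{val}(w) = [n] \setminus \lambda^{+}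 \text{ and } E_{pos}(w) = [n]\setminus \lambda^{-}\}$. *)

theory Defs
  imports "HOL-Combinatorics.Permutations"
begin

text \<open>The symmetric group on \<open>[n]\<close> is the set of all \<open>w :: nat \<Rightarrow> nat\<close> with
  \<open>w permutes {1..n}\<close>; such a \<open>w\<close> is the identity outside \<open>{1..n}\<close>.\<close>

definition Sym :: "nat \<Rightarrow> (nat \<Rightarrow> nat) set" where
  "Sym n = {w. w permutes {1..n}}"

definition avoids_321 :: "nat \<Rightarrow> (nat \<Rightarrow> nat) \<Rightarrow> bool" where
  "avoids_321 n w \<longleftrightarrow>
     \<not> (\<exists>i j k. 1 \<le> i \<and> i < j \<and> j < k \<and> k \<le> n \<and> w i > w j \<and> w j > w k)"

subsection \<open>Bruhat order\<close>

text \<open>The Coxeter length of \<open>w\<close>, i.e. its number of inversions.\<close>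

definition inv_count :: "nat \<Rightarrow> (nat \<Rightarrow> nat) \<Rightarrow> nat" where
  "inv_count n w = card {(i, j). 1 \<le> i \<and> i < j \<and> j \<le> n \<and> w i > w j}"

text \<open>The strong Bruhat order is the reflexive-transitive closure of \<open>u \<rightarrow> u t\<close>, where \<open>t\<close> is
  any transposition (reflection) that increases the length.\<close>

definition bruhat_step :: "nat \<Rightarrow> (nat \<Rightarrow> nat) \<Rightarrow> (nat \<Rightarrow> nat) \<Rightarrow> bool" where
  "bruhat_step n u w \<longleftrightarrow> u \<in> Sym n \<and> w \<in> Sym n \<and>
     (\<exists>i\<in>{1..n}. \<exists>j\<in>{1..n}. i \<noteq> j \<and> w = u \<circ> transpose i j) \<and>
     inv_count n u < inv_count n w"

definition bruhat_le :: "nat \<Rightarrow> (nat \<Rightarrow> nat) \<Rightarrow> (nat \<Rightarrow> nat) \<Rightarrow> bool" where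
  "bruhat_le n u w \<longleftrightarrow> u \<in> Sym n \<and> w \<in> Sym n \<and> (bruhat_step n)\<^sup>*\<^sup>* u w"

subsection \<open>Noncrossing partitions\<close>

definition noncrossing_partition :: "nat \<Rightarrow> (nat \<times> nat) set \<Rightarrow> bool" where
  "noncrossing_partition n lam \<longleftrightarrow>
     (\<forall>(i, j)\<in>lam. 1 \<le> i \<and> i < j \<and> j \<le> n) \<and>
     \<not> (\<exists>i j k l. (i, k) \<in> lam \<and> (j, l) \<in> lam \<and> (i, k) \<noteq> (j, l) \<and> i \<le> j \<and> j < k \<and> k \<le> l)"

definition left_ends :: "(nat \<times> nat) set \<Rightarrow> nat set" where
  "left_ends lam = fst ` lam"

definition right_ends :: "(nat \<times> nat) set \<Rightarrow> nat set" where
  "right_ends lam = snd ` lam"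

definition component :: "nat \<Rightarrow> (nat \<times> nat) set \<Rightarrow> nat \<Rightarrow> nat set" where
  "component n lam j = {k \<in> {1..n}. (j, k) \<in> (lam \<union> lam\<inverse>)\<^sup>*}"

text \<open>In a noncrossing partition distinct arcs have distinct right endpoints, so the \<open>THE\<close> below
  is well defined.\<close>

definition Q_perm :: "nat \<Rightarrow> (nat \<times> nat) set \<Rightarrow> nat \<Rightarrow> nat" where
  "Q_perm n lam j =
     (if j \<notin> {1..n} then j
      else if j \<in> right_ends lam then (THE i. (i, j) \<in> lam)
      else Max (component n lam j))"

subsection \<open>Excedance classes\<close>

definition E_pos :: "nat \<Rightarrow> (nat \<Rightarrow> nat) \<Rightarrow> nat set" where
  "E_pos n w = {i \<in> {1..n}. i \<le> w i}"

definition E_val :: "nat \<Rightarrow> (nat \<Rightarrow> nat) \<Rightarrow> nat set" where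
  "E_val n w = {w i | i. i \<in> {1..n} \<and> i \<le> w i}"

definition excedance_class :: "nat \<Rightarrow> (nat \<times> nat) set \<Rightarrow> (nat \<Rightarrow> nat) set" where
  "excedance_class n lam =
     {w \<in> Sym n. E_val n w = {1..n} - left_ends lam \<and> E_pos n w = {1..n} - right_ends lam}"

end

theory Submission
  imports Defs
begin

text \<open>The values of \<open>w\<close> at positions \<open>i \<le> w i\<close> and at positions \<open>w i < i\<close> can be rearranged
  separately without leaving the excedance class. Undoing an inversion within one of the two groups
  is a Bruhat descent, so every member lies above one that increases on both groups; that one is
  unique and avoids 321, as two of the three positions of a 321 pattern share a group. Undoing a
  crossing is a Bruhat ascent, so every member lies below a noncrossing one; that one is unique and
  equals \<open>Q\<close>. Conversely, the numbers \<open>#{x \<le> p. q \<le> w x}\<close> increase along the Bruhat order,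
  and their values for \<open>q \<in> {p, p + 1}\<close> both determine and are determined by the excedance class
  of \<open>w\<close>; so everything between two members of a class is again a member.\<close>

section \<open>Lengths and single steps of the Bruhat order\<close>

lemma inv_count_swap_less:
  assumes "i < j" "u i < u j" "1 \<le> i" "j \<le> n"
  shows "inv_count n u < inv_count n (u \<circ> transpose i j)"
proof -
  define t where "t = transpose i j"
  define Inv where "Inv v = {(x, y). 1 \<le> x \<and> x < y \<and> y \<le> n \<and> v x > v y}" for v :: "nat \<Rightarrow> nat"
  \<comment> \<open>\<open>\<phi>\<close> injects the inversions of \<open>u\<close> into those of \<open>u \<circ> t\<close>, missing \<open>(i, j)\<close>.\<close>
  define \<phi> where "\<phi> = (\<lambda>(x, y). if t x < t y then (t x, t y) else (x, y))"
  have tt: "t (t x) = x" for x by (simp add: t_def)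
  have fin: "finite (Inv v)" for v
    by (rule finite_subset[of _ "{1..n} \<times> {1..n}"]) (auto simp: Inv_def)
  have "inj_on \<phi> (Inv u)"
  proof (rule inj_onI)
    fix a b assume ab: "a \<in> Inv u" "b \<in> Inv u" "\<phi> a = \<phi> b"
    obtain x y x' y' where xy: "a = (x, y)" "b = (x', y')" by fastforce
    then have "x < y" "x' < y'" using ab by (auto simp: Inv_def)
    then show "a = b"
      using ab(3) unfolding xy \<phi>_def
      by (cases "t x < t y"; cases "t x' < t y'") (auto dest: arg_cong[where f = t] simp: tt)
  qed
  moreover have "\<phi> ` Inv u \<subseteq> Inv (u \<circ> t) - {(i, j)}"
  proof (rule image_subsetI)
    fix a assume "a \<in> Inv u"
    then obtain x y where a: "a = (x, y)" and xy: "1 \<le> x" "x < y" "y \<le> n" "u x > u y"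
      by (auto simp: Inv_def)
    show "\<phi> a \<in> Inv (u \<circ> t) - {(i, j)}"
      \<comment> \<open>If \<open>t\<close> reverses \<open>x < y\<close>, then \<open>x = i\<close>
        with \<open>y\<close> strictly between \<open>i\<close> and \<open>j\<close>, or
        \<open>y = j\<close> with \<open>x\<close> strictly between; as \<open>u i < u j\<close>,
        the pair stays an inversion after the swap.\<close>
      using xy assms unfolding a \<phi>_def Inv_def t_def
      by (auto simp: transpose_def split: if_splits)
  qed
  ultimately have "card (Inv u) \<le> card (Inv (u \<circ> t) - {(i, j)})"
    by (intro card_inj_on_le) (auto simp: fin)
  moreover have "(i, j) \<in> Inv (u \<circ> t)"
    using assms by (simp add: Inv_def t_def)
  then have "card (Inv (u \<circ> t) - {(i, j)}) < card (Inv (u \<circ> t))"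
    by (intro card_Diff1_less fin)
  ultimately show ?thesis by (simp add: Inv_def inv_count_def t_def)
qed

lemma inv_count_le: "inv_count n w \<le> n * n"
proof -
  have "inv_count n w \<le> card ({1..n} \<times> {1..n})"
    unfolding inv_count_def by (rule card_mono) auto
  then show ?thesis by simp
qed

lemma transpose_comp_Sym:
  assumes "u \<in> Sym n" "i \<in> {1..n}" "j \<in> {1..n}"
  shows "u \<circ> transpose i j \<in> Sym n"
  using assms unfolding Sym_def by (auto intro!: permutes_compose permutes_swap_id)

lemma bruhat_step_swap:
  assumes "u \<in> Sym n" "1 \<le> i" "i < j" "j \<le> n" "u i < u j"
  shows "bruhat_step n u (u \<circ> transpose i j)"
  unfolding bruhat_step_def
  using assms inv_count_swap_less[of i j u n] transpose_comp_Sym[of u n i j]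
  by (metis atLeastAtMost_iff le_trans less_imp_le nat_neq_iff)

lemma bruhat_step_swap_down:
  assumes "u \<in> Sym n" "1 \<le> i" "i < j" "j \<le> n" "u j < u i"
  shows "bruhat_step n (u \<circ> transpose i j) u"
  using bruhat_step_swap[of "u \<circ> transpose i j" n i j] transpose_comp_Sym[of u n i j] assms
  by (simp add: comp_assoc)

text \<open>Swapping a decreasing pair shortens the permutation, so a length-increasing
  transposition, once oriented by \<open>i < j\<close>, must swap an increasing pair.\<close>

lemma bruhat_stepE:
  assumes "bruhat_step n u w"
  obtains i j where "1 \<le> i" "i < j" "j \<le> n" "u i < u j" "w = u \<circ> transpose i j"
proof -
  obtain i j where ij: "1 \<le> i" "i < j" "j \<le> n" "w = u \<circ> transpose i j"
    using assms unfolding bruhat_step_def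
    by (metis atLeastAtMost_iff nat_neq_iff transpose_commute)
  have u: "u \<in> Sym n" and less: "inv_count n u < inv_count n w"
    using assms by (auto simp: bruhat_step_def)
  have "inj u" using u by (auto simp: Sym_def intro: permutes_inj)
  then have "u i \<noteq> u j" using ij by (auto dest: injD)
  moreover have "\<not> u j < u i"
    using bruhat_step_swap_down[OF u ij(1-3)] less ij(4) by (auto simp: bruhat_step_def)
  ultimately show thesis using that ij by auto
qed

lemma bruhat_le_refl: "u \<in> Sym n \<Longrightarrow> bruhat_le n u u"
  by (simp add: bruhat_le_def)

lemma bruhat_le_trans: "bruhat_le n u v \<Longrightarrow> bruhat_le n v w \<Longrightarrow> bruhat_le n u w"
  by (auto simp: bruhat_le_def)

lemma bruhat_step_imp_le: "bruhat_step n u v \<Longrightarrow> bruhat_le n u v"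
  unfolding bruhat_le_def using bruhat_step_def by blast

section \<open>The rank matrix of a permutation and its monotonicity\<close>

definition bruhat_rank :: "(nat \<Rightarrow> nat) \<Rightarrow> nat \<Rightarrow> nat \<Rightarrow> nat" where
  "bruhat_rank w p q = card {x \<in> {1..p}. q \<le> w x}"

text \<open>A step moves the larger value to the earlier position. If the window
  \<open>{1..p}\<close> contains \<open>i\<close> but not \<open>j\<close>, its value at
  \<open>i\<close> grows; otherwise the transposition maps the window to itself.\<close>

lemma bruhat_rank_step:
  assumes "bruhat_step n u w"
  shows "bruhat_rank u p q \<le> bruhat_rank w p q"
proof -
  obtain i j where ij: "1 \<le> i" "i < j" "u i < u j" "w = u \<circ> transpose i j"
    using assms by (rule bruhat_stepE)
  show ?thesis
  proof (cases "i \<le> p \<and> p < j")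
    case True
    then have "{x \<in> {1..p}. q \<le> u x} \<subseteq> {x \<in> {1..p}. q \<le> w x}"
      using ij by (auto simp: transpose_def)
    then show ?thesis unfolding bruhat_rank_def by (intro card_mono) auto
  next
    case False
    then have "transpose i j ` {x \<in> {1..p}. q \<le> u x} \<subseteq> {x \<in> {1..p}. q \<le> w x}"
      using ij by (auto simp: transpose_def)
    then show ?thesis unfolding bruhat_rank_def
      by (intro card_inj_on_le[of "transpose i j"]) auto
  qed
qed

lemma bruhat_rank_mono:
  assumes "bruhat_le n u w"
  shows "bruhat_rank u p q \<le> bruhat_rank w p q"
proof -
  have "(bruhat_step n)\<^sup>*\<^sup>* u w" using assms by (simp add: bruhat_le_def)
  then show ?thesis
    by induction (auto intro: order_trans bruhat_rank_step)
qed

lemma bruhat_rank_Suc_pos: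
  "bruhat_rank w (Suc p) q = bruhat_rank w p q + (if q \<le> w (Suc p) then 1 else 0)"
proof -
  have "{x \<in> {1..Suc p}. q \<le> w x} =
      (if q \<le> w (Suc p) then insert (Suc p) {x \<in> {1..p}. q \<le> w x} else {x \<in> {1..p}. q \<le> w x})"
    by (auto simp: le_Suc_eq)
  then show ?thesis by (simp add: bruhat_rank_def)
qed

text \<open>By injectivity, raising the threshold past \<open>w x\<close> can lose only the position
  \<open>x\<close>. Writing the value as \<open>w x\<close> avoids the inverse permutation.\<close>

lemma bruhat_rank_Suc_val:
  assumes "inj w"
  shows "bruhat_rank w p (w x) = bruhat_rank w p (Suc (w x)) + (if x \<in> {1..p} then 1 else 0)"
proof -
  have "w x \<le> w y \<longleftrightarrow> y = x \<or> Suc (w x) \<le> w y" for y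
    using injD[OF assms, of x y] by (auto simp: Suc_le_eq)
  then have "{y \<in> {1..p}. w x \<le> w y} =
      (if x \<in> {1..p} then insert x {y \<in> {1..p}. Suc (w x) \<le> w y} else {y \<in> {1..p}. Suc (w x) \<le> w y})"
    by auto
  then show ?thesis by (simp add: bruhat_rank_def)
qed

section \<open>Pointwise membership in an excedance class, and swaps that preserve it\<close>

lemma excedance_class_iff:
  "w \<in> excedance_class n lam \<longleftrightarrow> w \<in> Sym n \<and>
     (\<forall>i\<in>{1..n}. (i \<in> right_ends lam \<longleftrightarrow> w i < i) \<and> (w i \<in> left_ends lam \<longleftrightarrow> w i < i))"
  (is "_ \<longleftrightarrow> _ \<and> ?P")
proof (cases "w \<in> Sym n")
  case True
  then have w: "w permutes {1..n}" by (simp add: Sym_def)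
  have "E_pos n w = {1..n} - right_ends lam \<longleftrightarrow> (\<forall>i\<in>{1..n}. i \<in> right_ends lam \<longleftrightarrow> w i < i)"
  proof -
    have "E_pos n w = {i \<in> {1..n}. \<not> w i < i}" by (simp add: E_pos_def not_less)
    then show ?thesis by blast
  qed
  moreover have "E_val n w = {1..n} - left_ends lam \<longleftrightarrow>
      (\<forall>i\<in>{1..n}. w i \<in> left_ends lam \<longleftrightarrow> w i < i)"
  proof -
    have "E_val n w = w ` {i \<in> {1..n}. \<not> w i < i}" by (auto simp: E_val_def not_less)
    \<comment> \<open>Every value has the form \<open>w i\<close>, so both sides become images under
      \<open>w\<close>, and injectivity reduces the equation to one between sets of
      positions.\<close>
    moreover have "{1..n} - left_ends lam = w ` {i \<in> {1..n}. w i \<notin> left_ends lam}"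
    proof -
      have "w ` {i \<in> {1..n}. w i \<notin> left_ends lam} = w ` {1..n} - left_ends lam" by auto
      then show ?thesis by (simp only: permutes_image[OF w])
    qed
    ultimately have "E_val n w = {1..n} - left_ends lam \<longleftrightarrow>
        {i \<in> {1..n}. \<not> w i < i} = {i \<in> {1..n}. w i \<notin> left_ends lam}"
      by (simp add: inj_image_eq_iff permutes_inj[OF w])
    then show ?thesis by blast
  qed
  ultimately show ?thesis using True by (auto simp: excedance_class_def)
qed (simp add: excedance_class_def)

lemma excedance_class_permutes: "w \<in> excedance_class n lam \<Longrightarrow> w permutes {1..n}"
  by (simp add: excedance_class_def Sym_def)

text \<open>The hypothesis says that each of the positions \<open>i\<close>, \<open>j\<close>
  compares in the same way with each of the values \<open>w i\<close>, \<open>w j\<close>, so the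
  swap changes the kind of no position and of no value.\<close>

lemma excedance_class_swap:
  assumes w: "w \<in> excedance_class n lam" and ij: "i \<in> {1..n}" "j \<in> {1..n}"
    and "w i < i \<and> w j < j \<and> w i < j \<and> w j < i \<or>
         i \<le> w i \<and> j \<le> w j \<and> i \<le> w j \<and> j \<le> w i"
  shows "w \<circ> transpose i j \<in> excedance_class n lam"
proof -
  have "w \<circ> transpose i j \<in> Sym n"
    using transpose_comp_Sym w ij by (auto simp: excedance_class_iff)
  moreover have "(k \<in> right_ends lam \<longleftrightarrow> (w \<circ> transpose i j) k < k) \<and>
      ((w \<circ> transpose i j) k \<in> left_ends lam \<longleftrightarrow> (w \<circ> transpose i j) k < k)" if "k \<in> {1..n}" for k
  proof -
    have R: "l \<in> right_ends lam \<longleftrightarrow> w l < l" and L: "w l \<in> left_ends lam \<longleftrightarrow> w l < l"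
      if "l \<in> {1..n}" for l
      using w that by (auto simp: excedance_class_iff)
    consider "k = i" | "k = j" | "k \<noteq> i" "k \<noteq> j" by blast
    then show ?thesis
    proof cases
      case 1
      then show ?thesis using R[OF ij(1)] L[OF ij(2)] assms(4) by auto
    next
      case 2
      then show ?thesis using R[OF ij(2)] L[OF ij(1)] assms(4) by auto
    next
      case 3
      then show ?thesis using R[OF that] L[OF that] by simp
    qed
  qed
  ultimately show ?thesis by (simp add: excedance_class_iff)
qed

subsection \<open>The minimum of an excedance class\<close>

definition sorted_exc :: "nat \<Rightarrow> (nat \<Rightarrow> nat) \<Rightarrow> bool" where
  "sorted_exc n w \<longleftrightarrow>
     (\<forall>i j. 1 \<le> i \<and> i < j \<and> j \<le> n \<and> (w i < i \<longleftrightarrow> w j < j) \<longrightarrow> w i < w j)"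

lemma sorted_excD:
  "sorted_exc n w \<Longrightarrow> 1 \<le> i \<Longrightarrow> i < j \<Longrightarrow> j \<le> n \<Longrightarrow> w i < i \<longleftrightarrow> w j < j \<Longrightarrow> w i < w j"
  unfolding sorted_exc_def by blast

lemma sorted_exc_avoids_321: "sorted_exc n w \<Longrightarrow> avoids_321 n w"
  unfolding sorted_exc_def avoids_321_def
  by (smt (verit) le_trans less_imp_le less_trans not_less_iff_gr_or_eq)

text \<open>For a decreasing pair within one group, \<open>w j < w i < i < j\<close> or
  \<open>i < j \<le> w j < w i\<close>; either chain gives all comparisons needed for a swap inside
  the class. Induction on the length then applies.\<close>

lemma excedance_class_sorted_below:
  assumes "w \<in> excedance_class n lam"
  shows "\<exists>v \<in> excedance_class n lam. sorted_exc n v \<and> bruhat_le n v w"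
  using assms
proof (induction "inv_count n w" arbitrary: w rule: less_induct)
  case less
  have w: "w \<in> Sym n" using less.prems by (simp add: excedance_class_def)
  show ?case
  proof (cases "sorted_exc n w")
    case True
    then show ?thesis using less.prems w bruhat_le_refl by blast
  next
    case False
    then obtain i j where ij: "1 \<le> i" "i < j" "j \<le> n" "w i < i \<longleftrightarrow> w j < j" "w j \<le> w i"
      by (auto simp: sorted_exc_def not_less)
    have "w i \<noteq> w j"
      using ij excedance_class_permutes[OF less.prems] by (metis permutes_inj injD nat_neq_iff)
    with ij have gt: "w j < w i" by simp
    have step: "bruhat_step n (w \<circ> transpose i j) w"
      using bruhat_step_swap_down w ij gt by blast
    have "w \<circ> transpose i j \<in> excedance_class n lam"
      using ij gt by (intro excedance_class_swap less.prems) auto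
    then show ?thesis
      using less.hyps[of "w \<circ> transpose i j"] step bruhat_le_trans bruhat_step_imp_le
      by (metis bruhat_step_def)
  qed
qed

text \<open>At the last difference \<open>p\<close>, let \<open>y\<close> have the larger value. In
  \<open>x\<close> this value sits at some \<open>q < p\<close>, giving a decreasing pair
  \<open>q\<close>, \<open>p\<close> of one group.\<close>

lemma sorted_exc_unique:
  assumes v: "v \<in> excedance_class n lam" "sorted_exc n v"
    and w: "w \<in> excedance_class n lam" "sorted_exc n w"
  shows "v = w"
proof (rule ccontr)
  assume "v \<noteq> w"
  define D where "D = {p. v p \<noteq> w p}"
  have D: "D \<subseteq> {1..n}"
    using permutes_not_in[OF excedance_class_permutes[OF v(1)]]
      permutes_not_in[OF excedance_class_permutes[OF w(1)]]
    unfolding D_def by force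
  define p where "p = Max D"
  have fin: "finite D" using D finite_subset by blast
  have "p \<in> D" unfolding p_def using fin \<open>v \<noteq> w\<close> by (intro Max_in) (auto simp: D_def)
  have max: "q \<le> p" if "v q \<noteq> w q" for q
    unfolding p_def using fin that by (intro Max_ge) (auto simp: D_def)
  have False if "x \<in> excedance_class n lam" "y \<in> excedance_class n lam" "sorted_exc n x"
      "x p < y p" and same: "\<And>q. q > p \<Longrightarrow> x q = y q" for x y
  proof -
    note perm = that(1,2)[THEN excedance_class_permutes]
    have p: "p \<in> {1..n}" using \<open>p \<in> D\<close> D by auto
    have "y p \<in> {1..n}" using permutes_in_image[OF perm(2)] p by blast
    then obtain q where q: "q \<in> {1..n}" "x q = y p"
      using permutes_image[OF perm(1)] by (metis imageE)
    have "q \<noteq> p" using q that(4) by auto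
    moreover have "\<not> q > p" using same[of q] q permutes_inj[OF perm(2)]
      by (metis injD less_irrefl)
    ultimately have "q < p" by simp
    \<comment> \<open>Membership of the shared value \<open>x q = y p\<close> in
      \<open>left_ends lam\<close> fixes the kind of \<open>q\<close> in \<open>x\<close> and of
      \<open>p\<close> in \<open>y\<close>; the latter is the kind of \<open>p\<close> in
      \<open>x\<close>, through \<open>right_ends lam\<close>.\<close>
    moreover have "x q < q \<longleftrightarrow> x p < p"
      using that(1,2) p q by (metis excedance_class_iff)
    ultimately have "x q < x p"
      using sorted_excD[OF that(3), of q p] p q \<open>q < p\<close> by simp
    then show False using q that(4) by simp
  qed
  from this[of v w] this[of w v] show False
    using v w max \<open>p \<in> D\<close> unfolding D_def
    by (metis (mono_tags) mem_Collect_eq nat_neq_iff not_less)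
qed

subsection \<open>The maximum of an excedance class\<close>

text \<open>The excluded patterns are the crossings of the arc diagram of \<open>w\<close>, drawn
  with \<open>i \<le> w i\<close> above the line and \<open>w i < i\<close> below it; arcs that
  merely touch (\<open>j = w i\<close>) count as crossing only above.\<close>

definition uncrossed_exc :: "nat \<Rightarrow> (nat \<Rightarrow> nat) \<Rightarrow> bool" where
  "uncrossed_exc n w \<longleftrightarrow>
     (\<forall>i j. 1 \<le> i \<and> i < j \<and> j \<le> n \<longrightarrow>
        \<not> (j \<le> w i \<and> w i < w j) \<and> \<not> (w i < w j \<and> w j < i))"

lemma uncrossed_excD:
  assumes "uncrossed_exc n w" "1 \<le> i" "i < j" "j \<le> n"
  shows "\<not> (j \<le> w i \<and> w i < w j)" "\<not> (w i < w j \<and> w j < i)"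
  using assms unfolding uncrossed_exc_def by blast+

text \<open>Swapping a crossing stays in the class and raises the length, which is at most
  \<open>n * n\<close>; hence the decreasing measure.\<close>

lemma excedance_class_uncrossed_above:
  assumes "w \<in> excedance_class n lam"
  shows "\<exists>v \<in> excedance_class n lam. uncrossed_exc n v \<and> bruhat_le n w v"
  using assms
proof (induction "n * n - inv_count n w" arbitrary: w rule: less_induct)
  case less
  have w: "w \<in> Sym n" using less.prems by (simp add: excedance_class_def)
  show ?case
  proof (cases "uncrossed_exc n w")
    case True
    then show ?thesis using less.prems w bruhat_le_refl by blast
  next
    case False
    then obtain i j where ij: "1 \<le> i" "i < j" "j \<le> n" "w i < w j" "j \<le> w i \<or> w j < i"
      by (auto simp: uncrossed_exc_def)
    have step: "bruhat_step n w (w \<circ> transpose i j)"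
      using bruhat_step_swap w ij by blast
    then have "inv_count n w < inv_count n (w \<circ> transpose i j)"
      by (simp add: bruhat_step_def)
    then have "n * n - inv_count n (w \<circ> transpose i j) < n * n - inv_count n w"
      using inv_count_le[of n "w \<circ> transpose i j"] by linarith
    moreover have "w \<circ> transpose i j \<in> excedance_class n lam"
      using ij by (intro excedance_class_swap less.prems) auto
    ultimately show ?thesis
      using less.hyps[of "w \<circ> transpose i j"] step bruhat_le_trans bruhat_step_imp_le
      by blast
  qed
qed

lemma uncrossed_exc_unique:
  assumes v: "v \<in> excedance_class n lam" "uncrossed_exc n v"
    and w: "w \<in> excedance_class n lam" "uncrossed_exc n w"
  shows "v = w"
proof (rule ccontr)
  assume "v \<noteq> w"
  define D where "D = {p. v p \<noteq> w p}"
  have D: "D \<subseteq> {1..n}"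
    using permutes_not_in[OF excedance_class_permutes[OF v(1)]]
      permutes_not_in[OF excedance_class_permutes[OF w(1)]]
    unfolding D_def by force
  have fin: "finite D" using D finite_subset by blast
  \<comment> \<open>Two members differing at a position \<open>i \<le> w i\<close> yield a crossing at the last such position,
    two members differing at a position \<open>w i < i\<close> at the first one.\<close>
  have weak: False if xy: "x \<in> excedance_class n lam" "y \<in> excedance_class n lam"
      and "uncrossed_exc n x" and p: "p \<in> {1..n}" "p \<notin> right_ends lam" and "y p < x p"
      and same: "\<And>q. q > p \<Longrightarrow> q \<notin> right_ends lam \<Longrightarrow> x q = y q" for x y p
  proof -
    note perm = xy[THEN excedance_class_permutes]
    have "y p \<in> {1..n}" using permutes_in_image[OF perm(2)] p by blast
    then obtain q where q: "q \<in> {1..n}" "x q = y p"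
      using permutes_image[OF perm(1)] by (metis imageE)
    have "p \<le> y p" "q \<notin> right_ends lam"
      using xy p q by (metis excedance_class_iff not_less)+
    have "q \<noteq> p" using q \<open>y p < x p\<close> by auto
    moreover have "\<not> q > p" using same[of q] q \<open>q \<notin> _\<close> permutes_inj[OF perm(2)]
      by (metis injD less_irrefl)
    ultimately have "q < p" by simp
    \<comment> \<open>The larger member crosses: \<open>q < p \<le> x q < x p\<close>.\<close>
    then show False
      using uncrossed_excD(1)[OF \<open>uncrossed_exc n x\<close>, of q p] p q \<open>p \<le> y p\<close> \<open>y p < x p\<close> by simp
  qed
  have strict: False if xy: "x \<in> excedance_class n lam" "y \<in> excedance_class n lam"
      and "uncrossed_exc n y" and p: "p \<in> {1..n}" "p \<in> right_ends lam" and "y p < x p"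
      and same: "\<And>q. q < p \<Longrightarrow> q \<in> right_ends lam \<Longrightarrow> x q = y q" for x y p
  proof -
    note perm = xy[THEN excedance_class_permutes]
    have "x p \<in> {1..n}" using permutes_in_image[OF perm(1)] p by blast
    then obtain q where q: "q \<in> {1..n}" "y q = x p"
      using permutes_image[OF perm(2)] by (metis imageE)
    have "x p < p" "q \<in> right_ends lam"
      using xy p q by (metis excedance_class_iff)+
    have "q \<noteq> p" using q \<open>y p < x p\<close> by auto
    moreover have "\<not> q < p" using same[of q] q \<open>q \<in> right_ends lam\<close> permutes_inj[OF perm(1)]
      by (metis injD less_irrefl)
    ultimately have "p < q" by simp
    \<comment> \<open>Here the smaller member crosses: \<open>y p < y q < p < q\<close>.\<close>
    then show False
      using uncrossed_excD(2)[OF \<open>uncrossed_exc n y\<close>, of p q] p q \<open>x p < p\<close> \<open>y p < x p\<close> by simp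
  qed
  show False
  \<comment> \<open>\<open>weak\<close> and \<open>strict\<close> need agreement only within one
    group, so the extremal position is chosen within the group where a difference occurs.\<close>
  proof (cases "D \<subseteq> right_ends lam")
    case False
    define p where "p = Max (D - right_ends lam)"
    have "p \<in> D - right_ends lam" unfolding p_def using fin False by (intro Max_in) auto
    moreover have "v q = w q" if "q > p" "q \<notin> right_ends lam" for q
    proof (rule ccontr)
      assume "v q \<noteq> w q"
      then have "q \<le> p" unfolding p_def using fin that by (intro Max_ge) (auto simp: D_def)
      then show False using that by simp
    qed
    ultimately show False
      using weak[of v w p] weak[of w v p] v w D
      by (metis (mono_tags, lifting) D_def DiffE mem_Collect_eq nat_neq_iff subsetD)
  next
    case True
    define p where "p = Min D"
    have "p \<in> D" unfolding p_def using fin \<open>v \<noteq> w\<close> by (intro Min_in) (auto simp: D_def)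
    moreover have "v q = w q" if "q < p" for q
    proof (rule ccontr)
      assume "v q \<noteq> w q"
      then have "p \<le> q" unfolding p_def using fin that by (intro Min_le) (auto simp: D_def)
      then show False using that by simp
    qed
    ultimately show False
      using strict[of v w p] strict[of w v p] v w D True
      by (metis (mono_tags, lifting) D_def mem_Collect_eq nat_neq_iff subsetD)
  qed
qed

subsection \<open>Convexity of an excedance class\<close>

text \<open>Positions \<open>x \<le> p\<close> with \<open>x \<le> w x\<close> have values above
  \<open>p\<close> or at most \<open>p\<close>. The map \<open>w\<close> matches the latter with the
  values in \<open>{1..p}\<close> outside \<open>left_ends lam\<close>, whose positions are
  automatically at most \<open>p\<close>. So the rank depends on \<open>lam\<close> alone.\<close>

lemma excedance_class_rank_superdiag:
  assumes w: "w \<in> excedance_class n lam" and p: "p \<le> n"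
  shows "bruhat_rank w p (Suc p) = card ({1..p} - right_ends lam) - card ({1..p} - left_ends lam)"
proof -
  note perm = excedance_class_permutes[OF w]
  define X where "X = {x \<in> {1..p}. x \<le> w x \<and> w x \<le> p}"
  have R: "{1..p} - right_ends lam = {x \<in> {1..p}. Suc p \<le> w x} \<union> X"
    using w p by (auto simp: X_def excedance_class_iff not_less)
  have "w ` X = {1..p} - left_ends lam"
  proof (intro equalityI subsetI)
    fix y assume y: "y \<in> {1..p} - left_ends lam"
    then have "y \<in> {1..n}" using p by auto
    then obtain x where x: "x \<in> {1..n}" "y = w x"
      using permutes_image[OF perm] by (metis imageE)
    then have "x \<le> w x" using w y by (metis DiffD2 excedance_class_iff not_less)
    then show "y \<in> w ` X" using x y by (auto simp: X_def)
  next
    fix y assume "y \<in> w ` X"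
    then show "y \<in> {1..p} - left_ends lam"
      using w p by (auto simp: X_def excedance_class_iff)
  qed
  then have "card X = card ({1..p} - left_ends lam)"
    using card_image[of w X] permutes_inj_on[OF perm] by metis
  moreover have "card ({1..p} - right_ends lam) = bruhat_rank w p (Suc p) + card X"
    unfolding R bruhat_rank_def by (rule card_Un_disjoint) (auto simp: X_def)
  ultimately show ?thesis by simp
qed

lemma excedance_class_rank_diag:
  assumes w: "w \<in> excedance_class n lam" and p: "p \<in> {1..n}"
  shows "bruhat_rank w p p = bruhat_rank w (p - 1) p + (if p \<in> right_ends lam then 0 else 1)"
  using bruhat_rank_Suc_pos[of w "p - 1" p] w p by (auto simp: excedance_class_iff)

text \<open>The ranks on and just above the diagonal agree for \<open>u\<close> and
  \<open>v\<close>, hence by monotonicity also for \<open>w\<close>; their differences recover the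
  class.\<close>

lemma excedance_class_convex:
  assumes u: "u \<in> excedance_class n lam" and v: "v \<in> excedance_class n lam"
    and uw: "bruhat_le n u w" and wv: "bruhat_le n w v"
  shows "w \<in> excedance_class n lam"
proof -
  have super: "bruhat_rank w p (Suc p) = bruhat_rank u p (Suc p)" if "p \<le> n" for p
    using bruhat_rank_mono[OF uw, of p "Suc p"] bruhat_rank_mono[OF wv, of p "Suc p"]
      excedance_class_rank_superdiag[OF u that] excedance_class_rank_superdiag[OF v that] by simp
  have "bruhat_rank u p p = bruhat_rank v p p" if "p \<in> {1..n}" for p
  proof -
    have "p - 1 \<le> n" and p: "Suc (p - 1) = p" using that by auto
    then have "bruhat_rank u (p - 1) p = bruhat_rank v (p - 1) p"
      using excedance_class_rank_superdiag[OF u, of "p - 1"]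
        excedance_class_rank_superdiag[OF v, of "p - 1"] unfolding p by presburger
    then show ?thesis
      using excedance_class_rank_diag[OF u that] excedance_class_rank_diag[OF v that] by presburger
  qed
  then have diag: "bruhat_rank w p p = bruhat_rank u p p" if "p \<in> {1..n}" for p
    using bruhat_rank_mono[OF uw, of p p] bruhat_rank_mono[OF wv, of p p] that by simp
  have w: "w \<in> Sym n" using uw by (simp add: bruhat_le_def)
  then have perm: "w permutes {1..n}" by (simp add: Sym_def)
  note permu = excedance_class_permutes[OF u]
  have "(i \<in> right_ends lam \<longleftrightarrow> w i < i) \<and> (w i \<in> left_ends lam \<longleftrightarrow> w i < i)"
    if i: "i \<in> {1..n}" for i
  proof
    have Suc: "Suc (i - 1) = i" using i by auto
    \<comment> \<open>Changing the position bound tests the position \<open>i\<close>; the entry at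
      \<open>(i - 1, i)\<close> is again superdiagonal.\<close>
    have "bruhat_rank w i i = bruhat_rank w (i - 1) i + (if i \<in> right_ends lam then 0 else 1)"
    proof -
      have "i - 1 \<le> n" using i by auto
      then have "bruhat_rank w (i - 1) i = bruhat_rank u (i - 1) i"
        using super[of "i - 1"] unfolding Suc by blast
      then show ?thesis using excedance_class_rank_diag[OF u i] diag[OF i] by presburger
    qed
    then have "(if i \<in> right_ends lam then 0 else 1 :: nat) = (if i \<le> w i then 1 else 0)"
      using bruhat_rank_Suc_pos[of w "i - 1" i] unfolding Suc by (metis add_left_cancel)
    then show "i \<in> right_ends lam \<longleftrightarrow> w i < i" by (simp split: if_splits)
    have wi: "w i \<in> {1..n}" using permutes_in_image[OF perm] i by blast
    then obtain x where x: "x \<in> {1..n}" "w i = u x"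
      using permutes_image[OF permu] by (metis imageE)
    \<comment> \<open>Changing the threshold tests the value \<open>w i\<close>; the test is moved
      to \<open>u\<close>, where this value sits at \<open>x\<close>.\<close>
    have "i \<le> w i \<longleftrightarrow> bruhat_rank w (w i) (w i) \<noteq> bruhat_rank w (w i) (Suc (w i))"
      using bruhat_rank_Suc_val[OF permutes_inj[OF perm], of "w i" i] i by auto
    also have "\<dots> \<longleftrightarrow> bruhat_rank u (u x) (u x) \<noteq> bruhat_rank u (u x) (Suc (u x))"
      using diag[OF wi] super[of "w i"] wi x by simp
    also have "\<dots> \<longleftrightarrow> x \<le> u x"
      using bruhat_rank_Suc_val[OF permutes_inj[OF permu], of "u x" x] x by auto
    also have "\<dots> \<longleftrightarrow> w i \<notin> left_ends lam"
      using u x by (auto simp: excedance_class_iff)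
    finally show "w i \<in> left_ends lam \<longleftrightarrow> w i < i" by auto
  qed
  then show ?thesis using w by (simp add: excedance_class_iff)
qed

subsection \<open>The permutation of a noncrossing partition\<close>

context
  fixes n :: nat and lam :: "(nat \<times> nat) set"
  assumes nc: "noncrossing_partition n lam"
begin

lemma arc_bounds: "(i, j) \<in> lam \<Longrightarrow> 1 \<le> i \<and> i < j \<and> j \<le> n"
  using nc by (auto simp: noncrossing_partition_def)

lemma arcs_noncrossing:
  "(i, k) \<in> lam \<Longrightarrow> (j, l) \<in> lam \<Longrightarrow> (i, k) \<noteq> (j, l) \<Longrightarrow> i \<le> j \<Longrightarrow> j < k \<Longrightarrow> k \<le> l \<Longrightarrow> False"
  using nc unfolding noncrossing_partition_def by blast

text \<open>The weak inequalities in the noncrossing condition also forbid distinct arcs with a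
  common right endpoint.\<close>

lemma arc_right_unique: "(i, k) \<in> lam \<Longrightarrow> (j, k) \<in> lam \<Longrightarrow> i = j"
  using arcs_noncrossing[of i k j k] arcs_noncrossing[of j k i k] arc_bounds
  by (metis nat_le_linear order_refl prod.inject)

lemma arc_left_unique: "(i, k) \<in> lam \<Longrightarrow> (i, l) \<in> lam \<Longrightarrow> k = l"
  using arcs_noncrossing[of i k i l] arcs_noncrossing[of i l i k] arc_bounds
  by (metis nat_le_linear order_refl prod.inject)

lemma path_le: "(i, j) \<in> lam\<^sup>* \<Longrightarrow> i \<le> j"
  by (induction rule: rtrancl_induct) (auto dest: arc_bounds)

text \<open>A backward step from a vertex on a forward path from \<open>j\<close> retraces its only
  incoming arc, and none enters \<open>j\<close>; so undirected paths reach nothing new.\<close>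

lemma component_minimal:
  assumes "j \<in> {1..n}" "j \<notin> right_ends lam"
  shows "component n lam j = {k. (j, k) \<in> lam\<^sup>*}"
proof (intro equalityI subsetI)
  fix k assume "k \<in> component n lam j"
  then have "(j, k) \<in> (lam \<union> lam\<inverse>)\<^sup>*" by (simp add: component_def)
  then have "(j, k) \<in> lam\<^sup>*"
  proof (induction rule: rtrancl_induct)
    case (step y z)
    from step.hyps(2) consider "(y, z) \<in> lam" | "(z, y) \<in> lam" by auto
    then show ?case
    proof cases
      case 2
      from step.IH show ?thesis
      proof (cases rule: rtranclE)
        case base
        then show ?thesis using 2 assms by (force simp: right_ends_def)
      next
        case (step y')
        then show ?thesis using 2 arc_right_unique by metis
      qed
    qed (use step.IH in auto)
  qed simp
  then show "k \<in> {k. (j, k) \<in> lam\<^sup>*}" by simp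
next
  fix k assume "k \<in> {k. (j, k) \<in> lam\<^sup>*}"
  then have k: "(j, k) \<in> lam\<^sup>*" by simp
  then have "k \<in> {1..n}"
    using assms(1) by (induction rule: rtrancl_induct) (auto dest: arc_bounds)
  moreover have "(j, k) \<in> (lam \<union> lam\<inverse>)\<^sup>*"
    using k rtrancl_mono[of lam "lam \<union> lam\<inverse>"] by blast
  ultimately show "k \<in> component n lam j" by (simp add: component_def)
qed

lemma Q_perm_right_end:
  assumes "(i, j) \<in> lam"
  shows "Q_perm n lam j = i"
proof -
  have "j \<in> right_ends lam" using assms by (force simp: right_ends_def)
  moreover have "(THE i. (i, j) \<in> lam) = i"
    using assms arc_right_unique by blast
  ultimately show ?thesis using arc_bounds[OF assms] by (simp add: Q_perm_def)
qed

lemma Q_perm_minimal: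
  assumes "j \<in> {1..n}" "j \<notin> right_ends lam"
  shows "(j, Q_perm n lam j) \<in> lam\<^sup>*" "Q_perm n lam j \<notin> left_ends lam" "Q_perm n lam j \<in> {1..n}"
proof -
  let ?C = "component n lam j"
  have Q: "Q_perm n lam j = Max ?C" using assms by (simp add: Q_perm_def)
  have fin: "finite ?C" by (simp add: component_def)
  have "?C \<noteq> {}" using assms by (auto simp: component_minimal)
  with fin have "Q_perm n lam j \<in> ?C" unfolding Q by (rule Max_in)
  then show path: "(j, Q_perm n lam j) \<in> lam\<^sup>*"
    and "Q_perm n lam j \<in> {1..n}"
    using component_minimal[OF assms] by (auto simp: component_def)
  show "Q_perm n lam j \<notin> left_ends lam"
  proof
    assume "Q_perm n lam j \<in> left_ends lam"
    then obtain k where k: "(Q_perm n lam j, k) \<in> lam" by (auto simp: left_ends_def)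
    then have "k \<in> ?C" using path component_minimal[OF assms] by auto
    then have "k \<le> Q_perm n lam j" unfolding Q using fin by simp
    then show False using arc_bounds[OF k] by simp
  qed
qed

lemma path_crosses_arc:
  assumes "(i, k) \<in> lam\<^sup>*" "i < j" "j \<le> k"
  obtains a b where "(a, b) \<in> lam" "a < j" "j \<le> b" "b \<le> k"
  using assms
proof (induction arbitrary: thesis rule: rtrancl_induct)
  case (step y z)
  show ?case
  proof (cases "j \<le> y")
    case True
    then show ?thesis using step.IH step.prems arc_bounds[OF step.hyps(2)]
      by (metis le_trans less_imp_le)
  next
    case False
    then show ?thesis using step by auto
  qed
qed auto

text \<open>An arc from strictly inside \<open>(a, b)\<close> to \<open>b\<close> or beyond would
  cross \<open>(a, b)\<close>, so an increasing path that starts inside stays inside.\<close>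

lemma path_below_arc:
  assumes "(j, k) \<in> lam\<^sup>*" "(a, b) \<in> lam" "a < j" "j < b"
  shows "k < b"
  using assms
proof (induction rule: rtrancl_induct)
  case (step y z)
  then have "y < b" "a < y" using path_le by (auto intro: less_le_trans)
  then show ?case
    using arcs_noncrossing[OF \<open>(a, b) \<in> lam\<close> step.hyps(2)] by (metis less_imp_le nat_neq_iff not_less prod.inject)
qed

text \<open>The path from \<open>i\<close> to its component maximum jumps \<open>j\<close> by an arc
  \<open>(a, b)\<close>. As \<open>j\<close> is no right endpoint, \<open>j < b\<close>, and the
  path from \<open>j\<close> is trapped below \<open>b\<close>.\<close>

lemma Q_perm_uncrossed_minimal:
  assumes "i \<in> {1..n}" "j \<in> {1..n}" "i \<notin> right_ends lam" "j \<notin> right_ends lam"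
    and "i < j" "j \<le> Q_perm n lam i"
  shows "Q_perm n lam j < Q_perm n lam i"
proof -
  obtain a b where ab: "(a, b) \<in> lam" "a < j" "j \<le> b" "b \<le> Q_perm n lam i"
    using path_crosses_arc[OF Q_perm_minimal(1)] assms by metis
  have "b \<in> right_ends lam" using ab by (force simp: right_ends_def)
  then have "j < b" using ab assms by (metis le_neq_implies_less)
  then show ?thesis using path_below_arc[OF Q_perm_minimal(1)] assms ab by (meson less_le_trans)
qed

lemma Q_perm_less_iff:
  assumes "j \<in> {1..n}"
  shows "j \<in> right_ends lam \<longleftrightarrow> Q_perm n lam j < j"
    and "Q_perm n lam j \<in> left_ends lam \<longleftrightarrow> Q_perm n lam j < j"
    and "Q_perm n lam j \<in> {1..n}"
proof -
  have "Q_perm n lam j < j \<and> Q_perm n lam j \<in> left_ends lam \<and> Q_perm n lam j \<in> {1..n}"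
    if R: "j \<in> right_ends lam"
  proof -
    obtain i where i: "(i, j) \<in> lam" using R by (auto simp: right_ends_def)
    then have "i \<in> left_ends lam" by (force simp: left_ends_def)
    then show ?thesis using i arc_bounds[OF i] Q_perm_right_end[OF i] by auto
  qed
  moreover have "j \<le> Q_perm n lam j \<and> Q_perm n lam j \<notin> left_ends lam \<and> Q_perm n lam j \<in> {1..n}"
    if "j \<notin> right_ends lam"
    using Q_perm_minimal[OF assms that] path_le by blast
  ultimately show "j \<in> right_ends lam \<longleftrightarrow> Q_perm n lam j < j"
    "Q_perm n lam j \<in> left_ends lam \<longleftrightarrow> Q_perm n lam j < j" "Q_perm n lam j \<in> {1..n}"
    by (metis not_less)+
qed

lemma right_end_arc: "j \<in> right_ends lam \<Longrightarrow> (Q_perm n lam j, j) \<in> lam"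
  using Q_perm_right_end by (auto simp: right_ends_def)

text \<open>A common value forces both positions into the same group. Two right endpoints would then
  share a left endpoint; two others would contradict the strict inequality of
  \<open>Q_perm_uncrossed_minimal\<close>.\<close>

lemma Q_perm_Sym: "Q_perm n lam \<in> Sym n"
proof -
  have neq: "Q_perm n lam i \<noteq> Q_perm n lam j"
    if ij: "i \<in> {1..n}" "j \<in> {1..n}" "i < j" for i j
  proof
    assume eq: "Q_perm n lam i = Q_perm n lam j"
    show False
    proof (cases "i \<in> right_ends lam")
      case True
      then have "j \<in> right_ends lam" using Q_perm_less_iff eq ij by metis
      then show False
        using True right_end_arc[of i] right_end_arc[of j] arc_left_unique eq ij by (metis nat_neq_iff)
    next
      case False
      then have j: "j \<notin> right_ends lam" using Q_perm_less_iff eq ij by metis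
      then have "j \<le> Q_perm n lam j" using Q_perm_less_iff(1)[of j] ij by simp
      then show False using Q_perm_uncrossed_minimal[of i j] False j eq ij by simp
    qed
  qed
  have "inj_on (Q_perm n lam) {1..n}"
    by (rule linorder_inj_onI) (use neq in auto)
  moreover have "Q_perm n lam ` {1..n} \<subseteq> {1..n}" using Q_perm_less_iff(3) by blast
  ultimately have "bij_betw (Q_perm n lam) {1..n} {1..n}"
    by (simp add: bij_betw_def endo_inj_surj)
  then show ?thesis
    unfolding Sym_def by (auto intro!: bij_imp_permutes simp: Q_perm_def)
qed

lemma Q_perm_in_excedance_class: "Q_perm n lam \<in> excedance_class n lam"
  using Q_perm_Sym Q_perm_less_iff by (auto simp: excedance_class_iff)

text \<open>A crossing below the line would be a crossing of the arcs of \<open>lam\<close> ending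
  at \<open>i\<close> and \<open>j\<close>; one above contradicts
  \<open>Q_perm_uncrossed_minimal\<close>.\<close>

lemma Q_perm_uncrossed: "uncrossed_exc n (Q_perm n lam)"
proof -
  let ?Q = "Q_perm n lam"
  have False if ij: "1 \<le> i" "i < j" "j \<le> n" and cross: "?Q i < ?Q j" "j \<le> ?Q i \<or> ?Q j < i" for i j
  proof (cases "j \<le> ?Q i")
    case True
    then have "i \<notin> right_ends lam" "j \<notin> right_ends lam"
      using Q_perm_less_iff(1)[of i] Q_perm_less_iff(1)[of j] ij cross(1) by auto
    then show False using Q_perm_uncrossed_minimal[of i j] ij cross True by auto
  next
    case False
    then have "i \<in> right_ends lam" "j \<in> right_ends lam"
      using Q_perm_less_iff(1)[of i] Q_perm_less_iff(1)[of j] ij cross by auto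
    then show False
      using arcs_noncrossing[OF right_end_arc[of i] right_end_arc[of j]] ij cross False by auto
  qed
  then show ?thesis unfolding uncrossed_exc_def by blast
qed

end

theorem corollary4p3:
  fixes n :: nat and lam :: "(nat \<times> nat) set"
  assumes "noncrossing_partition n lam"
  shows "Q_perm n lam \<in> Sym n \<and>
    (\<exists>T \<in> Sym n. avoids_321 n T \<and> bruhat_le n T (Q_perm n lam) \<and>
       excedance_class n lam = {w \<in> Sym n. bruhat_le n T w \<and> bruhat_le n w (Q_perm n lam)})"
proof -
  let ?Q = "Q_perm n lam" and ?C = "excedance_class n lam"
  note Q = Q_perm_in_excedance_class[OF assms]
  \<comment> \<open>Membership of \<open>?Q\<close> makes the class nonempty; uniqueness of the
    sorted member then puts this \<open>T\<close> below every member.\<close>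
  obtain T where T: "T \<in> ?C" "sorted_exc n T" "bruhat_le n T ?Q"
    using excedance_class_sorted_below[OF Q] by blast
  have "bruhat_le n T w" if "w \<in> ?C" for w
    using excedance_class_sorted_below[OF that] sorted_exc_unique[OF _ _ T(1,2)] by blast
  moreover have "bruhat_le n w ?Q" if "w \<in> ?C" for w
    using excedance_class_uncrossed_above[OF that]
      uncrossed_exc_unique[OF _ _ Q Q_perm_uncrossed[OF assms]] by blast
  moreover have Sym: "?C \<subseteq> Sym n" by (auto simp: excedance_class_def)
  ultimately have "?C = {w \<in> Sym n. bruhat_le n T w \<and> bruhat_le n w ?Q}"
    using excedance_class_convex[OF T(1) Q] by blast
  then show ?thesis
    using T sorted_exc_avoids_321 Q Sym by blast
qed

end
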